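(* Let $k$ be a positive integer. For an integer $n\ge 0$, let $R_k(n)$ denote the number of partitions of $n$ whose Durfee triangle has size $k$. Then \[ \mathcal{F}_k(q):=\sum_{n=0}^{\infty} R_k(n)\,q^n=\frac{q^{k(k+1)/2}\,\varphi_k(q)}{(1-q)(1-q^2)\cdots(1-q^k)}, \] where \[ \varphi_k(q)=1+c_1q+\cdots+c_{k^2-1}q^{k^2-1}+(-1)^{k-1}q^{k^2} \] is a polynomial of degree $k^2$ with integer coefficients $c_1,\dots,c_{k^2-1}$. Moreover, if $k$ is odd then $\varphi_k(-1)=0$.
   Context: A partition of $n\ge 0$ is a tuple $\lambda=(\lambda_1,\dots,\lambda_d)$ of integers $\lambda_1\ge\cdots\ge\lambda_d\ge 1$ with sum $n$; set $\lambda_j=0$ for $j>d$. The Durfee triangle of $\lambda$ has size $k$ if $k$ is the largest integer such that $\lambda_j>k-j$ for all $j\in\{1,2,\dots,k\}$ (equivalently, the largest right isosceles triangle with apex at the top-left corner fitting in the Ferrers board has horizontal and vertical sides of length $k$). *)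

theory Defs
  imports "HOL-Computational_Algebra.Computational_Algebra"
begin

definition partitions :: "nat \<Rightarrow> nat list set" where
  "partitions n = {l. sorted_wrt (\<ge>) l \<and> (\<forall>x\<in>set l. 1 \<le> x) \<and> sum_list l = n}"

(* Parts are numbered from 1; parts beyond the last one are 0. *)
definition part :: "nat list \<Rightarrow> nat \<Rightarrow> nat" where
  "part l j = (if 1 \<le> j \<and> j \<le> length l then l ! (j - 1) else 0)"

(* The bound j \<le> k makes the subtraction on nat exact. *)
definition triangle_fits :: "nat list \<Rightarrow> nat \<Rightarrow> bool" where
  "triangle_fits l k \<longleftrightarrow> (\<forall>j\<in>{1..k}. part l j > k - j)"

definition durfee_triangle_size :: "nat list \<Rightarrow> nat" where
  "durfee_triangle_size l = (GREATEST k. triangle_fits l k)"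

(* The size is a genuine maximum: it is attained, and it bounds every fitting triangle. *)
lemma triangle_fits_le_length:
  assumes "triangle_fits l k"
  shows "k \<le> length l"
proof (cases "k = 0")
  case False
  then have "k \<in> {1..k}" by simp
  with assms have "part l k > k - k" unfolding triangle_fits_def by blast
  then show ?thesis by (auto simp: part_def split: if_splits)
qed simp

lemma triangle_fits_durfee_triangle_size: "triangle_fits l (durfee_triangle_size l)"
  unfolding durfee_triangle_size_def
  by (rule GreatestI_nat[where k = 0 and b = "length l"])
     (simp_all add: triangle_fits_le_length, simp add: triangle_fits_def)

lemma le_durfee_triangle_size: "triangle_fits l k \<Longrightarrow> k \<le> durfee_triangle_size l"
  unfolding durfee_triangle_size_def
  by (rule Greatest_le_nat[where b = "length l"]) (simp_all add: triangle_fits_le_length)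

lemma length_le_sum_list_pos:
  "\<forall>x\<in>set l. 1 \<le> (x::nat) \<Longrightarrow> length l \<le> sum_list l"
  by (induction l) auto

(* Finiteness makes the cardinality below an honest count. *)
lemma finite_partitions: "finite (partitions n)"
proof (rule finite_subset)
  show "partitions n \<subseteq> {l. set l \<subseteq> {..n} \<and> length l \<le> n}"
    using length_le_sum_list_pos by (auto simp: partitions_def intro: member_le_sum_list)
  show "finite {l. set l \<subseteq> {..n} \<and> length l \<le> n}"
    by (rule finite_lists_length_le) simp
qed

definition R :: "nat \<Rightarrow> nat \<Rightarrow> nat" where
  "R k n = card {l \<in> partitions n. durfee_triangle_size l = k}"

(* Rational coefficients, because division of power series needs a field of coefficients. *)
definition F :: "nat \<Rightarrow> rat fps" where
  "F k = Abs_fps (\<lambda>n. of_nat (R k n))"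

end

theory Submission
  imports Defs
begin

text \<open>
  Write \<open>(q)\<^sub>n = (1 - q)\<dots>(1 - q\<^sup>n)\<close>, let \<open>[n, c]\<close> be the generating function of the partitions in an
  \<open>n \<times> c\<close> box (a Gaussian binomial coefficient), \<open>t\<^sub>n = n(n+1)/2\<close>, and let \<open>G\<^sub>n\<close> be the generating
  function of the partitions with exactly \<open>n\<close> parts that contain the staircase \<open>(n, n-1, \<dots>, 1)\<close>.

  If the Durfee triangle of \<open>\<lambda>\<close> has size \<open>k\<close>, cut \<open>\<lambda>\<close> at the first row \<open>s+1\<close> that does not reach
  the staircase of size \<open>k+1\<close>. With \<open>m = k - s\<close>, the rows above, shortened by \<open>m+1\<close>, are counted by
  \<open>G\<^sub>s\<close>, and the rows below are, up to conjugation, counted by \<open>G\<^sub>m\<close>; so \<open>F\<^sub>k\<close> is the sum of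
  \<open>q\<close> to the \<open>s(m+1)\<close> times \<open>G\<^sub>s G\<^sub>m\<close>. Cutting an arbitrary partition with at most \<open>a\<close> parts at the
  first row that does not reach the staircase of size \<open>a\<close> gives in the same way
  \<open>1/(q)\<^sub>a = \<Sum>\<^sub>s q\<close> to the \<open>s(a-s)\<close> times \<open>G\<^sub>s [a-s, a-s-1]\<close>. By induction
  \<open>G\<^sub>a (q)\<^sub>a\<close> is \<open>q\<close> to the \<open>t\<^sub>a\<close> times a polynomial \<open>P\<^sub>a\<close> of degree \<open>a(a-1)\<close>, with constant term 1
  and leading coefficient \<open>(-1)\<close> to the \<open>a-1\<close> if \<open>a \<ge> 1\<close>, because the term \<open>s = 0\<close> dominates. Hence
  \<open>\<phi>\<^sub>k = \<Sum>\<^sub>s q\<^sup>s P\<^sub>s P\<^sub>m [s, m]\<close>, in which the term \<open>s = k\<close> alone has degree \<open>k\<^sup>2\<close>; for odd \<open>k\<close>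
  the exchange of \<open>s\<close> and \<open>m\<close> changes the sign of the terms at \<open>q = -1\<close>.
\<close>

subsection \<open>Generating functions of sets of lists\<close>

definition gf :: "nat list set \<Rightarrow> int fps" where
  "gf S = Abs_fps (\<lambda>n. int (card {l \<in> S. sum_list l = n}))"

text \<open>\<open>card\<close> is 0 on infinite sets, so additivity and the product rule for
  \<open>gf\<close> are proved for sets with finitely many lists of each sum.\<close>

definition level_finite :: "nat list set \<Rightarrow> bool" where
  "level_finite S \<longleftrightarrow> (\<forall>n. finite {l \<in> S. sum_list l = n})"

lemma level_finite_subset: "level_finite T \<Longrightarrow> S \<subseteq> T \<Longrightarrow> level_finite S"
  unfolding level_finite_def
  by (auto intro: finite_subset[rotated])

lemma gf_nth: "gf S $ n = int (card {l \<in> S. sum_list l = n})"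
  by (simp add: gf_def)

lemma gf_bij_betw:
  assumes "bij_betw f S T" "\<And>l. l \<in> S \<Longrightarrow> sum_list (f l) = d + sum_list l"
  shows "gf T = fps_X ^ d * gf S"
proof (rule fps_ext)
  fix n
  show "gf T $ n = (fps_X ^ d * gf S) $ n"
  proof (cases "n < d")
    case True
    have "{l \<in> T. sum_list l = n} = {}"
      using True assms by (fastforce simp: bij_betw_def)
    then have "gf T $ n = 0"
      by (simp only: gf_nth card.empty)
    with True show ?thesis
      by (simp add: fps_X_power_mult_nth)
  next
    case False
    have "bij_betw f {l \<in> S. sum_list l = n - d} {l \<in> T. sum_list l = n}"
      using False assms unfolding bij_betw_def
      by (auto simp: inj_on_def)
    then have "card {l \<in> S. sum_list l = n - d} = card {l \<in> T. sum_list l = n}"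
      by (rule bij_betw_same_card)
    with False show ?thesis
      by (simp add: fps_X_power_mult_nth gf_nth)
  qed
qed

lemma gf_UN:
  assumes "finite I" "\<And>i. i \<in> I \<Longrightarrow> level_finite (S i)"
    and "\<And>i j. i \<in> I \<Longrightarrow> j \<in> I \<Longrightarrow> i \<noteq> j \<Longrightarrow> S i \<inter> S j = {}"
  shows "gf (\<Union>i\<in>I. S i) = (\<Sum>i\<in>I. gf (S i))"
proof (rule fps_ext)
  fix n
  have "{l \<in> (\<Union>i\<in>I. S i). sum_list l = n} = (\<Union>i\<in>I. {l \<in> S i. sum_list l = n})"
    by auto
  moreover have "card (\<Union>i\<in>I. {l \<in> S i. sum_list l = n}) = (\<Sum>i\<in>I. card {l \<in> S i. sum_list l = n})"
  proof (rule card_UN_disjoint)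
    show "\<forall>i\<in>I. finite {l \<in> S i. sum_list l = n}"
      using assms(2) by (auto simp: level_finite_def)
    show "\<forall>i\<in>I. \<forall>j\<in>I. i \<noteq> j \<longrightarrow> {l \<in> S i. sum_list l = n} \<inter> {l \<in> S j. sum_list l = n} = {}"
      using assms(3) by blast
  qed (fact assms(1))
  ultimately show "gf (\<Union>i\<in>I. S i) $ n = (\<Sum>i\<in>I. gf (S i)) $ n"
    by (simp add: gf_nth fps_sum_nth)
qed

lemma gf_Un:
  assumes "level_finite S" "level_finite T" "S \<inter> T = {}"
  shows "gf (S \<union> T) = gf S + gf T"
proof (rule fps_ext)
  fix n
  have "{l \<in> S \<union> T. sum_list l = n} = {l \<in> S. sum_list l = n} \<union> {l \<in> T. sum_list l = n}"
    by auto
  moreover have "card ({l \<in> S. sum_list l = n} \<union> {l \<in> T. sum_list l = n})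
    = card {l \<in> S. sum_list l = n} + card {l \<in> T. sum_list l = n}"
    using assms by (intro card_Un_disjoint) (auto simp: level_finite_def)
  ultimately show "gf (S \<union> T) $ n = (gf S + gf T) $ n"
    by (simp add: gf_nth)
qed

text \<open>The common length \<open>s\<close> marks where to cut \<open>u @ v\<close>, so
  concatenation is injective and the sums convolve as in the Cauchy product.\<close>

lemma gf_append:
  assumes fin: "level_finite U" "level_finite V" and len: "\<And>u. u \<in> U \<Longrightarrow> length u = s"
  shows "gf ((\<lambda>(u, v). u @ v) ` (U \<times> V)) = gf U * gf V"
proof (rule fps_ext)
  fix n
  let ?L = "\<lambda>S n. {l \<in> S. sum_list l = n}"
  have "?L ((\<lambda>(u, v). u @ v) ` (U \<times> V)) n
      = (\<lambda>(u, v). u @ v) ` (\<Union>i\<in>{0..n}. ?L U i \<times> ?L V (n - i))"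
    by (auto simp: image_iff)
  moreover have "inj_on (\<lambda>(u, v). u @ v) (\<Union>i\<in>{0..n}. ?L U i \<times> ?L V (n - i))"
    using len by (auto simp: inj_on_def)
  moreover have "card (\<Union>i\<in>{0..n}. ?L U i \<times> ?L V (n - i))
      = (\<Sum>i=0..n. card (?L U i \<times> ?L V (n - i)))"
    using fin by (intro card_UN_disjoint) (auto simp: level_finite_def)
  ultimately show "gf ((\<lambda>(u, v). u @ v) ` (U \<times> V)) $ n = (gf U * gf V) $ n"
    by (simp add: gf_nth fps_mult_nth card_image card_cartesian_product)
qed

subsection \<open>Weakly decreasing lists and Gaussian binomial coefficients\<close>

text \<open>Lists in \<open>dec\<close> and \<open>box\<close> are padded with zeros to a fixed length;
  those in \<open>wide\<close> have arbitrary length and positive entries.\<close>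

definition dec :: "nat \<Rightarrow> nat list set" where
  "dec n = {l. length l = n \<and> sorted_wrt (\<ge>) l}"

definition box :: "nat \<Rightarrow> nat \<Rightarrow> nat list set" where
  "box n c = {l \<in> dec n. \<forall>x\<in>set l. x \<le> c}"

text \<open>Counted by G_n: indices start at 0, so row \<open>i\<close> of the staircase has
  \<open>n - i\<close> cells, and every entry is positive.\<close>

definition tall :: "nat \<Rightarrow> nat list set" where
  "tall n = {l \<in> dec n. \<forall>i<n. n - i \<le> l ! i}"

text \<open>The conjugates of the lists in \<open>tall m\<close>: the staircase is its own
  conjugate, and the length bound becomes a bound on the entries.\<close>

definition wide :: "nat \<Rightarrow> nat list set" where
  "wide m = {l. sorted_wrt (\<ge>) l \<and> (\<forall>x\<in>set l. 1 \<le> x \<and> x \<le> m) \<and>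
     (\<forall>i<m. i < length l \<and> m - i \<le> l ! i)}"

lemma level_finite_dec: "level_finite (dec n)"
  unfolding level_finite_def
proof
  fix m
  have "{l \<in> dec n. sum_list l = m} \<subseteq> {l. set l \<subseteq> {..m} \<and> length l = n}"
    by (auto simp: dec_def intro: member_le_sum_list)
  then show "finite {l \<in> dec n. sum_list l = m}"
    by (rule finite_subset) (simp add: finite_lists_length_eq)
qed

lemma level_finite_box: "level_finite (box n c)"
  by (rule level_finite_subset[OF level_finite_dec[of n]]) (auto simp: box_def)

lemma level_finite_UN_partitions: "level_finite (\<Union>n. partitions n)"
  unfolding level_finite_def
proof
  fix m
  have "{l \<in> (\<Union>n. partitions n). sum_list l = m} \<subseteq> partitions m"
    by (auto simp: partitions_def)
  then show "finite {l \<in> (\<Union>n. partitions n). sum_list l = m}"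
    by (rule finite_subset) (rule finite_partitions)
qed

lemma level_finite_wide: "level_finite (wide m)"
  by (rule level_finite_subset[OF level_finite_UN_partitions])
    (auto simp: wide_def partitions_def)

lemma dec_nth_mono: "l \<in> dec n \<Longrightarrow> i \<le> j \<Longrightarrow> j < n \<Longrightarrow> l ! j \<le> l ! i"
  unfolding dec_def by (cases "i = j") (auto simp: sorted_wrt_iff_nth_less)

lemma sum_list_map_add: "sum_list (map ((+) c) l) = c * length l + sum_list (l::nat list)"
  by (induction l) auto

lemma map_add_diff: "(\<And>x. x \<in> set l \<Longrightarrow> c \<le> x) \<Longrightarrow> map ((+) c) (map (\<lambda>x. x - c) l) = (l::nat list)"
  by (induction l) auto

text \<open>The last entry is the smallest. If it is 0, drop it; otherwise all entries are positive
  and removing the first column takes away \<open>Suc n\<close> cells.\<close>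

lemma gf_split_last:
  assumes "S \<subseteq> dec (Suc n)"
  shows "gf S = gf {l. l @ [0] \<in> S} + fps_X ^ Suc n * gf {l. map Suc l \<in> S}"
proof -
  have eq: "S = (\<lambda>l. l @ [0]) ` {l. l @ [0] \<in> S} \<union> map Suc ` {l. map Suc l \<in> S}" (is "_ = ?A \<union> ?B")
  proof (intro equalityI subsetI)
    fix l assume l: "l \<in> S"
    with assms have l': "length l = Suc n" "sorted_wrt (\<ge>) l"
      by (auto simp: dec_def)
    then obtain u x where u: "l = u @ [x]"
      by (metis length_0_conv nat.distinct(1) rev_exhaust)
    show "l \<in> ?A \<union> ?B"
    proof (cases x)
      case 0
      with u l show ?thesis by auto
    next
      case (Suc y)
      have "map Suc (map (\<lambda>x. x - 1) l) = l"
        using l' u Suc by (intro nth_equalityI) (auto simp: sorted_wrt_append nth_append dest!: nth_mem)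
      with l show ?thesis by (auto simp: image_iff intro!: exI[of _ "map (\<lambda>x. x - 1) l"])
    qed
  qed auto
  have disj: "?A \<inter> ?B = {}"
    by (auto simp: map_eq_append_conv append_eq_map_conv)
  have fin: "level_finite S"
    using level_finite_dec assms by (rule level_finite_subset)
  have sub: "?A \<subseteq> S" "?B \<subseteq> S" by auto
  have "gf S = gf ?A + gf ?B"
    using gf_Un[OF level_finite_subset[OF fin sub(1)] level_finite_subset[OF fin sub(2)] disj] eq
    by metis
  moreover have "gf ?A = fps_X ^ 0 * gf {l. l @ [0] \<in> S}"
    by (rule gf_bij_betw[where f = "\<lambda>l. l @ [0]"]) (auto simp: bij_betw_def inj_on_def)
  moreover have "gf ?B = fps_X ^ Suc n * gf {l. map Suc l \<in> S}"
  proof (rule gf_bij_betw[where f = "map Suc"])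
    show "bij_betw (map Suc) {l. map Suc l \<in> S} ?B"
      by (auto simp: bij_betw_def inj_on_def)
    fix l assume "l \<in> {l. map Suc l \<in> S}"
    with assms have "length l = Suc n" by (auto simp: dec_def)
    with sum_list_Suc[of "\<lambda>x. x" l] show "sum_list (map Suc l) = Suc n + sum_list l"
      by simp
  qed
  ultimately show ?thesis by simp
qed

section \<open>Product formulas for partitions with boundedly many parts and for partitions in a
  box\<close>

definition qfact :: "nat \<Rightarrow> int fps" where
  "qfact n = (\<Prod>i=1..n. 1 - fps_X ^ i)"

lemma qfact_0 [simp]: "qfact 0 = 1"
  and qfact_Suc: "qfact (Suc n) = qfact n * (1 - fps_X ^ Suc n)"
  by (simp_all add: qfact_def)

lemma qfact_nth_0 [simp]: "qfact n $ 0 = 1"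
  by (induction n) (simp_all add: qfact_Suc)

lemma qfact_nonzero [simp]: "qfact n \<noteq> 0"
  by (metis fps_zero_nth qfact_nth_0 zero_neq_one)

lemma gf_Nil: "gf {[]} = 1"
proof (rule fps_ext)
  fix n
  have "{l \<in> {[]::nat list}. sum_list l = n} = (if n = 0 then {[]} else {})"
    by auto
  then show "gf {[]} $ n = 1 $ n"
    by (simp add: gf_nth)
qed

lemma qfact_gf_dec: "qfact n * gf (dec n) = 1"
proof (induction n)
  case 0
  have "dec 0 = {[]}" by (auto simp: dec_def)
  then show ?case by (simp add: gf_Nil)
next
  case (Suc n)
  have "{l. l @ [0] \<in> dec (Suc n)} = dec n" "{l. map Suc l \<in> dec (Suc n)} = dec (Suc n)"
    by (auto simp: dec_def sorted_wrt_append sorted_wrt_map)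
  with gf_split_last[of "dec (Suc n)" n] have "gf (dec (Suc n)) = gf (dec n) + fps_X ^ Suc n * gf (dec (Suc n))"
    by simp
  then have "(1 - fps_X ^ Suc n) * gf (dec (Suc n)) = gf (dec n)"
    by (simp add: algebra_simps)
  with Suc show ?case
    by (metis qfact_Suc mult.assoc)
qed

lemma box_0_left: "box 0 c = {[]}"
  by (auto simp: box_def dec_def)

lemma box_0_right: "box n 0 = {replicate n 0}"
  by (auto simp: box_def dec_def sorted_wrt_iff_nth_less intro!: replicate_eqI)

lemma gf_box_0_right: "gf (box n 0) = 1"
proof -
  have "gf (box n 0) = fps_X ^ 0 * gf {[]}"
    by (rule gf_bij_betw[where f = "\<lambda>_. replicate n 0"])
      (auto simp: bij_betw_def box_0_right sum_list_replicate)
  then show ?thesis by (simp add: gf_Nil)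
qed

lemma gf_box_Suc: "gf (box (Suc n) (Suc c)) = gf (box n (Suc c)) + fps_X ^ Suc n * gf (box (Suc n) c)"
proof -
  have "{l. l @ [0] \<in> box (Suc n) (Suc c)} = box n (Suc c)"
    "{l. map Suc l \<in> box (Suc n) (Suc c)} = box (Suc n) c"
    by (auto simp: box_def dec_def sorted_wrt_append sorted_wrt_map)
  with gf_split_last[of "box (Suc n) (Suc c)" n] show ?thesis
    by (auto simp: box_def)
qed

text \<open>The Gaussian binomial formula with denominators cleared. The induction combines the
  q-Pascal rule \<open>gf_box_Suc\<close> with (1 - q^n) + q^n (1 - q^c) = 1 - q^(n+c).\<close>

lemma qfact_gf_box: "qfact n * qfact c * gf (box n c) = qfact (n + c)"
proof (induction "n + c" arbitrary: n c)
  case 0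
  then show ?case by (simp add: gf_Nil box_0_left)
next
  case (Suc N)
  consider "n = 0" | "c = 0" | n' c' where "n = Suc n'" "c = Suc c'"
    by (meson not0_implies_Suc)
  then show ?case
  proof cases
    case 3
    have 1: "qfact n' * qfact c * gf (box n' c) = qfact N"
      using Suc 3 by (metis add_Suc nat.inject)
    have 2: "qfact n * qfact c' * gf (box n c') = qfact N"
      using Suc 3 by (metis add_Suc_right nat.inject)
    have "qfact n * qfact c * gf (box n c)
       = (1 - fps_X ^ n) * (qfact n' * qfact c * gf (box n' c))
         + fps_X ^ n * (1 - fps_X ^ c) * (qfact n * qfact c' * gf (box n c'))"
      unfolding 3 gf_box_Suc qfact_Suc by (simp only: algebra_simps)
    also have "\<dots> = qfact N * (1 - fps_X ^ (n + c))"
      unfolding 1 2 by (simp add: algebra_simps power_add)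
    also have "\<dots> = qfact (n + c)"
      using Suc(2) by (metis qfact_Suc)
    finally show ?thesis .
  qed (simp_all add: gf_Nil box_0_left gf_box_0_right)
qed

subsection \<open>Decompositions along a staircase\<close>

text \<open>Describes the upper part of a cut partition: for \<open>c = a - s\<close> the bound is
  \<open>a - i\<close>, so the first \<open>s\<close> rows reach the staircase of size
  \<open>a\<close>; \<open>c = k - s + 1\<close> gives size \<open>k + 1\<close>.\<close>

lemma map_add_tall: "map ((+) c) ` tall s = {u \<in> dec s. \<forall>i<s. c + (s - i) \<le> u ! i}"
proof (intro equalityI subsetI)
  fix u assume "u \<in> {u \<in> dec s. \<forall>i<s. c + (s - i) \<le> u ! i}"
  then have u: "u \<in> dec s" "\<And>i. i < s \<Longrightarrow> c + (s - i) \<le> u ! i" by auto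
  then have len: "length u = s" by (simp add: dec_def)
  have ge: "c \<le> x" if "x \<in> set u" for x
    using that u(2) len by (metis add_leD1 in_set_conv_nth)
  have "map (\<lambda>x. x - c) u \<in> tall s"
    using u len ge unfolding tall_def dec_def
    by (auto simp: sorted_wrt_iff_nth_less le_diff_conv2 add.commute diff_le_mono)
  moreover have "u = map ((+) c) (map (\<lambda>x. x - c) u)"
    using map_add_diff ge by metis
  ultimately show "u \<in> map ((+) c) ` tall s" by blast
qed (auto simp: tall_def dec_def sorted_wrt_map)

lemma gf_map_add_tall: "gf (map ((+) c) ` tall s) = fps_X ^ (c * s) * gf (tall s)"
  by (rule gf_bij_betw[where f = "map ((+) c)"])
    (auto simp: bij_betw_def inj_on_def sum_list_map_add tall_def dec_def)

lemma level_finite_map_add_tall: "level_finite (map ((+) c) ` tall s)"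
  by (rule level_finite_subset[OF level_finite_dec[of s]]) (auto simp: map_add_tall)

text \<open>At \<open>s = a\<close> the truncated subtraction gives \<open>box 0 0\<close>, which contributes the factor 1.\<close>

lemma gf_dec_conv_tall:
  "gf (dec a) = (\<Sum>s\<le>a. fps_X ^ ((a - s) * s) * gf (tall s) * gf (box (a - s) (a - s - 1)))"
proof -
  \<comment> \<open>Here \<open>s\<close> is the 0-based index of the first row that misses the
    staircase of size \<open>a\<close>, or \<open>a\<close> if no row does.\<close>
  define D where "D s = {l \<in> dec a. (\<forall>i<s. a - i \<le> l ! i) \<and> (s = a \<or> l ! s < a - s)}" for s
  have D_eq: "D s = (\<lambda>(u, v). u @ v) ` (map ((+) (a - s)) ` tall s \<times> box (a - s) (a - s - 1))"
    if s: "s \<le> a" for s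
    unfolding map_add_tall
  proof (intro equalityI subsetI)
    fix l assume "l \<in> D s"
    then have l: "l \<in> dec a" "\<And>i. i < s \<Longrightarrow> a - i \<le> l ! i" "s = a \<or> l ! s < a - s"
      by (auto simp: D_def)
    then have len: "length l = a" by (simp add: dec_def)
    have "take s l \<in> {u \<in> dec s. \<forall>i<s. a - s + (s - i) \<le> u ! i}"
      using l s len by (auto simp: dec_def sorted_wrt_take)
    \<comment> \<open>Row \<open>s\<close> is already too short, and the later rows are no longer
      than it.\<close>
    moreover have "x \<le> a - s - 1" if x: "x \<in> set (drop s l)" for x
    proof -
      obtain i where "i < a - s" "x = l ! (s + i)"
        using x len s by (auto simp: in_set_conv_nth)
      moreover from this have "l ! (s + i) \<le> l ! s" "l ! s < a - s"
        using l(3) s dec_nth_mono[OF l(1), of s "s + i"] by auto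
      ultimately show ?thesis by linarith
    qed
    then have "drop s l \<in> box (a - s) (a - s - 1)"
      using l len by (auto simp: box_def dec_def sorted_wrt_drop)
    ultimately show "l \<in> (\<lambda>(u, v). u @ v) ` ({u \<in> dec s. \<forall>i<s. a - s + (s - i) \<le> u ! i} \<times> box (a - s) (a - s - 1))"
      by (intro image_eqI[of _ _ "(take s l, drop s l)"]) auto
  next
    fix l assume "l \<in> (\<lambda>(u, v). u @ v) ` ({u \<in> dec s. \<forall>i<s. a - s + (s - i) \<le> u ! i} \<times> box (a - s) (a - s - 1))"
    then obtain u v where l: "l = u @ v" "u \<in> dec s" "\<And>i. i < s \<Longrightarrow> a - s + (s - i) \<le> u ! i"
      "v \<in> box (a - s) (a - s - 1)" by auto
    have len: "length u = s" "length v = a - s"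
      using l by (auto simp: dec_def box_def)
    have xu: "a - s \<le> x" if "x \<in> set u" for x
      using that l(3) len by (metis add_leD1 in_set_conv_nth)
    have xv: "x \<le> a - s - 1" if "x \<in> set v" for x
      using that l(4) by (auto simp: box_def)
    have "sorted_wrt (\<ge>) l"
      using l xu order_trans[OF xv diff_le_self] by (auto simp: sorted_wrt_append dec_def box_def intro: order_trans)
    then have "l \<in> dec a"
      using l len s by (simp add: dec_def)
    moreover have "a - i \<le> l ! i" if "i < s" for i
      using l(3)[OF that] that s l(1) len by (simp add: nth_append)
    moreover have "l ! s < a - s" if "s \<noteq> a"
      using that s l(1) len xv[of "v ! 0"] by (simp add: nth_append)
    ultimately show "l \<in> D s" by (auto simp: D_def)
  qed
  have "dec a = (\<Union>s\<in>{..a}. D s)"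
  proof (intro equalityI subsetI)
    fix l assume l: "l \<in> dec a"
    define P where "P s \<longleftrightarrow> s = a \<or> l ! s < a - s" for s
    have "P a" by (simp add: P_def)
    then have "P (LEAST s. P s)" "(LEAST s. P s) \<le> a" "\<And>i. i < (LEAST s. P s) \<Longrightarrow> \<not> P i"
      by (auto intro: LeastI Least_le dest: not_less_Least)
    with l show "l \<in> (\<Union>s\<in>{..a}. D s)"
      by (intro UN_I[of "LEAST s. P s"]) (auto simp: D_def P_def not_less)
  qed (auto simp: D_def)
  then have "gf (dec a) = gf (\<Union>s\<in>{..a}. D s)" by simp
  also have "\<dots> = (\<Sum>s\<le>a. gf (D s))"
  proof (rule gf_UN)
    show "level_finite (D s)" for s
      by (rule level_finite_subset[OF level_finite_dec[of a]]) (auto simp: D_def)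
    fix s t assume st: "s \<in> {..a}" "t \<in> {..a}" "s \<noteq> t"
    \<comment> \<open>The larger of the two indices forces the row at the smaller one to reach the
      staircase, which the other set forbids.\<close>
    have False if "l \<in> D s" "l \<in> D t" for l
      using that st by (cases s t rule: linorder_cases) (auto simp: D_def not_le[symmetric])
    then show "D s \<inter> D t = {}" by blast
  qed simp
  also have "\<dots> = (\<Sum>s\<le>a. fps_X ^ ((a - s) * s) * gf (tall s) * gf (box (a - s) (a - s - 1)))"
  proof (rule sum.cong)
    fix s assume "s \<in> {..a}"
    then have "gf (D s) = gf (map ((+) (a - s)) ` tall s) * gf (box (a - s) (a - s - 1))"
      by (simp only: D_eq atMost_iff, intro gf_append[where s = s])
        (rule level_finite_map_add_tall level_finite_box | auto simp: tall_def dec_def)+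
    then show "gf (D s) = fps_X ^ ((a - s) * s) * gf (tall s) * gf (box (a - s) (a - s - 1))"
      by (simp add: gf_map_add_tall)
  qed simp
  finally show ?thesis .
qed

section \<open>Conjugation of partitions\<close>

definition conjugate :: "nat \<Rightarrow> nat list \<Rightarrow> nat list" where
  "conjugate n l = map (\<lambda>i. card {j. j < length l \<and> i < l ! j}) [0..<n]"

lemma length_conjugate [simp]: "length (conjugate n l) = n"
  by (simp add: conjugate_def)

text \<open>Conjugation transposes cells: in a decreasing list the rows longer than \<open>i\<close>
  form an initial segment, so their number is the first index outside it.\<close>

lemma less_conjugate_nth_iff:
  assumes "sorted_wrt (\<ge>) l" "i < n"
  shows "j < conjugate n l ! i \<longleftrightarrow> j < length l \<and> i < l ! j"
proof -
  define A where "A = {j. j < length l \<and> i < l ! j}"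
  define m where "m = (LEAST j. j \<notin> A)"
  have "length l \<notin> A" by (simp add: A_def)
  then have "m \<notin> A" unfolding m_def by (rule LeastI)
  have down: "j' \<in> A" if "j \<in> A" "j' \<le> j" for j j'
  proof (cases "j' = j")
    case False
    with that assms(1) have "l ! j \<le> l ! j'"
      by (auto simp: A_def sorted_wrt_iff_nth_less)
    with that show ?thesis by (auto simp: A_def)
  qed (use that in simp)
  have "A = {..<m}"
  proof (intro equalityI subsetI)
    fix j assume "j \<in> A"
    with down \<open>m \<notin> A\<close> show "j \<in> {..<m}" by (metis lessThan_iff not_le)
  next
    fix j assume "j \<in> {..<m}"
    then show "j \<in> A" unfolding m_def using not_less_Least by auto
  qed
  moreover have "conjugate n l ! i = card A"
    using assms(2) by (simp add: conjugate_def A_def)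
  ultimately show ?thesis
    by (metis (mono_tags, lifting) A_def card_lessThan lessThan_iff mem_Collect_eq)
qed

lemma sorted_conjugate:
  assumes "sorted_wrt (\<ge>) l"
  shows "sorted_wrt (\<ge>) (conjugate n l)"
  unfolding sorted_wrt_iff_nth_less
proof (intro allI impI)
  fix i j assume "i < j" "j < length (conjugate n l)"
  then have "x < conjugate n l ! j \<Longrightarrow> x < conjugate n l ! i" for x
    using assms by (auto simp: less_conjugate_nth_iff)
  then show "conjugate n l ! j \<le> conjugate n l ! i"
    by (meson le_refl not_le)
qed

text \<open>Counts the cells by columns and by rows; the bound \<open>n\<close> on the entries
  ensures that no column is cut off.\<close>

lemma sum_list_conjugate:
  assumes "\<And>x. x \<in> set l \<Longrightarrow> x \<le> n"
  shows "sum_list (conjugate n l) = sum_list l"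
proof -
  have "sum_list (conjugate n l) = (\<Sum>i<n. card {j \<in> {..<length l}. i < l ! j})"
    by (simp add: sum_list_sum_nth conjugate_def atLeast0LessThan)
  also have "\<dots> = (\<Sum>i<n. \<Sum>j<length l. if i < l ! j then 1 else 0)"
    by (simp add: sum.inter_filter[symmetric])
  also have "\<dots> = (\<Sum>j<length l. \<Sum>i<n. if i < l ! j then 1 else 0)"
    by (rule sum.swap)
  also have "\<dots> = (\<Sum>j<length l. l ! j)"
  proof (rule sum.cong)
    fix j assume "j \<in> {..<length l}"
    with assms have "{i \<in> {..<n}. i < l ! j} = {..<l ! j}"
      by (auto dest!: nth_mem intro: less_le_trans)
    then show "(\<Sum>i<n. if i < l ! j then 1 else 0) = l ! j"
      by (simp add: sum.inter_filter[symmetric])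
  qed simp
  also have "\<dots> = sum_list l"
    by (simp add: sum_list_sum_nth atLeast0LessThan)
  finally show ?thesis .
qed

lemma conjugate_conjugate:
  assumes "sorted_wrt (\<ge>) l" "\<And>x. x \<in> set l \<Longrightarrow> x \<le> n"
  shows "conjugate (length l) (conjugate n l) = l"
proof (rule nth_equalityI)
  fix j assume "j < length (conjugate (length l) (conjugate n l))"
  then have j: "j < length l" by simp
  have "l ! j \<le> n"
    using assms(2) j by simp
  have "x < conjugate (length l) (conjugate n l) ! j \<longleftrightarrow> x < l ! j" for x
    using less_conjugate_nth_iff[OF sorted_conjugate[OF assms(1)] j, of x n]
      less_conjugate_nth_iff[OF assms(1), of x n j] j \<open>l ! j \<le> n\<close> by auto
  then show "conjugate (length l) (conjugate n l) ! j = l ! j"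
    by (metis less_irrefl linorder_cases)
qed simp

text \<open>Conjugation is a sum-preserving bijection. Entries of \<open>wide m\<close> are
  positive, so for \<open>m > 0\<close> the first entry of the conjugate records the original
  length; hence the parameter \<open>t ! 0\<close> of the inverse.\<close>

lemma gf_wide: "gf (wide m) = gf (tall m)"
proof (cases "m = 0")
  case True
  have "l = []" if "l \<in> wide 0" for l
    using that by (cases l) (auto simp: wide_def)
  then have "wide 0 = {[]}"
    by (auto simp: wide_def)
  moreover have "tall 0 = {[]}"
    by (auto simp: tall_def dec_def)
  ultimately show ?thesis using True by simp
next
  case False
  have conj_tall: "conjugate m l \<in> tall m" if "l \<in> wide m" for l
  proof -
    have l: "sorted_wrt (\<ge>) l" "\<And>i. i < m \<Longrightarrow> i < length l \<and> m - i \<le> l ! i"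
      using that by (auto simp: wide_def)
    have "m - i \<le> conjugate m l ! i" if "i < m" for i
    proof -
      \<comment> \<open>Row \<open>m - i - 1\<close> of \<open>l\<close> has at least
        \<open>m - (m - i - 1) = i + 1\<close> cells, so it meets column \<open>i\<close>.\<close>
      have "m - i - 1 < conjugate m l ! i"
        using l(2)[of "m - i - 1"] that by (subst less_conjugate_nth_iff[OF l(1) that]) auto
      with that show ?thesis by simp
    qed
    with l show ?thesis by (simp add: tall_def dec_def sorted_conjugate)
  qed
  have conj_wide: "conjugate (t ! 0) t \<in> wide m" if "t \<in> tall m" for t
  proof -
    have t: "sorted_wrt (\<ge>) t" "length t = m" "\<And>i. i < m \<Longrightarrow> m - i \<le> t ! i"
      using that by (auto simp: tall_def dec_def)
    let ?l = "conjugate (t ! 0) t"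
    have "1 \<le> ?l ! j \<and> ?l ! j \<le> m" if "j < t ! 0" for j
      \<comment> \<open>Cell 0 of the row is present, which gives the lower bound; cell
        \<open>m\<close> is absent because \<open>t\<close> has only \<open>m\<close> rows.\<close>
      using less_conjugate_nth_iff[OF t(1) that, of 0] less_conjugate_nth_iff[OF t(1) that, of m] that t(2) False
      by auto
    then have "\<forall>x\<in>set ?l. 1 \<le> x \<and> x \<le> m"
      by (metis in_set_conv_nth length_conjugate)
    moreover have "i < t ! 0 \<and> m - i \<le> ?l ! i" if "i < m" for i
    proof -
      have i: "i < t ! 0"
        using t(3)[of 0] that by simp
      have "m - i - 1 < ?l ! i"
        using t(2) t(3)[of "m - i - 1"] that by (subst less_conjugate_nth_iff[OF t(1) i]) auto
      with i show ?thesis by simp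
    qed
    ultimately show ?thesis
      by (simp add: wide_def sorted_conjugate[OF t(1)])
  qed
  have hd_conj: "conjugate m l ! 0 = length l" if "l \<in> wide m" for l
  proof -
    have "{j. j < length l \<and> 0 < l ! j} = {..<length l}"
      using that by (auto simp: wide_def Suc_le_eq)
    then show ?thesis using False by (simp add: conjugate_def)
  qed
  have "bij_betw (conjugate m) (wide m) (tall m)"
  proof (rule bij_betw_byWitness[where f' = "\<lambda>t. conjugate (t ! 0) t"])
    show "\<forall>l\<in>wide m. conjugate (conjugate m l ! 0) (conjugate m l) = l"
      by (auto simp: hd_conj) (auto simp: wide_def intro: conjugate_conjugate)
    show "\<forall>t\<in>tall m. conjugate m (conjugate (t ! 0) t) = t"
    proof
      fix t assume "t \<in> tall m"
      then have t: "t \<in> dec m" "sorted_wrt (\<ge>) t" "length t = m"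
        by (auto simp: tall_def dec_def)
      have "x \<le> t ! 0" if "x \<in> set t" for x
        using that dec_nth_mono[OF t(1), of 0] t(3) by (auto simp: in_set_conv_nth)
      with conjugate_conjugate[OF t(2)] t(3) show "conjugate m (conjugate (t ! 0) t) = t" by metis
    qed
  qed (use conj_tall conj_wide in auto)
  moreover have "sum_list (conjugate m l) = 0 + sum_list l" if "l \<in> wide m" for l
    using that by (auto simp: wide_def intro: sum_list_conjugate)
  ultimately have "gf (tall m) = fps_X ^ 0 * gf (wide m)"
    by (rule gf_bij_betw)
  then show ?thesis by simp
qed

section \<open>The decomposition by the size of the Durfee triangle\<close>

lemma triangle_fits_iff_nth: "triangle_fits l k \<longleftrightarrow> (\<forall>i<k. i < length l \<and> k - i \<le> l ! i)"
proof -
  have "triangle_fits l k \<longleftrightarrow> (\<forall>i<k. part l (Suc i) > k - Suc i)"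
    unfolding triangle_fits_def image_Suc_lessThan[symmetric]
    by (simp only: ball_simps) auto
  \<comment> \<open>\<open>part\<close> counts from 1 and is 0 past the end; with \<open>!\<close>
    the length has to be tested separately.\<close>
  moreover have "part l (Suc i) > k - Suc i \<longleftrightarrow> i < length l \<and> k - i \<le> l ! i" if "i < k" for i
    using that by (simp add: part_def Suc_le_eq) linarith
  ultimately show ?thesis by blast
qed

lemma triangle_fits_mono:
  assumes "triangle_fits l k" "j \<le> k"
  shows "triangle_fits l j"
  unfolding triangle_fits_iff_nth
proof (intro allI impI)
  fix i assume "i < j"
  with assms have "i < length l \<and> k - i \<le> l ! i"
    by (simp add: triangle_fits_iff_nth)
  with assms(2) show "i < length l \<and> j - i \<le> l ! i" by linarith
qed

text \<open>Fitting is inherited by smaller triangles, so the maximum is determined by testing two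
  consecutive sizes.\<close>

lemma durfee_triangle_size_eq_iff:
  "durfee_triangle_size l = k \<longleftrightarrow> triangle_fits l k \<and> \<not> triangle_fits l (Suc k)"
proof
  assume "durfee_triangle_size l = k"
  then show "triangle_fits l k \<and> \<not> triangle_fits l (Suc k)"
    using triangle_fits_durfee_triangle_size[of l] le_durfee_triangle_size[of l "Suc k"] by auto
next
  assume fits: "triangle_fits l k \<and> \<not> triangle_fits l (Suc k)"
  then have "\<not> Suc k \<le> durfee_triangle_size l"
    using triangle_fits_mono[OF triangle_fits_durfee_triangle_size] by blast
  moreover have "k \<le> durfee_triangle_size l"
    using fits by (simp add: le_durfee_triangle_size)
  ultimately show "durfee_triangle_size l = k" by simp
qed

lemma gf_durfee_triangle_size:
  "gf {l. sorted_wrt (\<ge>) l \<and> (\<forall>x\<in>set l. 1 \<le> x) \<and> durfee_triangle_size l = k}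
   = (\<Sum>s\<le>k. fps_X ^ ((k - s + 1) * s) * gf (tall s) * gf (tall (k - s)))"
proof -
  \<comment> \<open>Row \<open>s\<close> is the first one missing the staircase of size
    \<open>k + 1\<close>. It may be an empty row past the end, hence the implication in the last
    condition.\<close>
  define E where "E s = {l. sorted_wrt (\<ge>) l \<and> (\<forall>x\<in>set l. 1 \<le> x) \<and> triangle_fits l k
    \<and> (\<forall>i<s. i < length l \<and> k + 1 - i \<le> l ! i) \<and> (s < length l \<longrightarrow> l ! s \<le> k - s)}" for s
  let ?U = "\<lambda>s. {u \<in> dec s. \<forall>i<s. k - s + 1 + (s - i) \<le> u ! i}"
  have E_eq: "E s = (\<lambda>(u, v). u @ v) ` (map ((+) (k - s + 1)) ` tall s \<times> wide (k - s))"
    if s: "s \<le> k" for s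
    unfolding map_add_tall
  proof (intro equalityI subsetI)
    fix l assume "l \<in> E s"
    then have l: "sorted_wrt (\<ge>) l" "\<forall>x\<in>set l. 1 \<le> x"
      "\<And>i. i < k \<Longrightarrow> i < length l \<and> k - i \<le> l ! i"
      "\<And>i. i < s \<Longrightarrow> i < length l \<and> k + 1 - i \<le> l ! i" "s < length l \<Longrightarrow> l ! s \<le> k - s"
      by (auto simp: E_def triangle_fits_iff_nth)
    have len: "s \<le> length l"
      using l(4) by (meson less_irrefl not_le)
    have "k - s + 1 + (s - i) \<le> l ! i" if "i < s" for i
      using l(4)[OF that] that s by linarith
    then have "take s l \<in> ?U s"
      using l(1) len by (auto simp: dec_def sorted_wrt_take)
    moreover have "x \<le> k - s" if x: "x \<in> set (drop s l)" for x
    proof -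
      obtain i where i: "i < length l - s" "x = l ! (s + i)"
        using x by (auto simp: in_set_conv_nth)
      then have "l ! (s + i) \<le> l ! s"
        by (intro dec_nth_mono[of _ "length l"]) (auto simp: dec_def l(1))
      with i l(5) show ?thesis by linarith
    qed
    \<comment> \<open>The fitting triangle of size \<open>k\<close> leaves a staircase of size
      \<open>k - s\<close> below the cut.\<close>
    moreover have "i < length (drop s l) \<and> k - s - i \<le> drop s l ! i" if "i < k - s" for i
      using l(3)[of "s + i"] that len by (simp add: less_diff_conv add.commute)
    ultimately have "take s l \<in> ?U s" "drop s l \<in> wide (k - s)"
      using l(1,2) by (auto simp: wide_def sorted_wrt_drop dest: in_set_dropD)
    then show "l \<in> (\<lambda>(u, v). u @ v) ` (?U s \<times> wide (k - s))"
      by (intro image_eqI[of _ _ "(take s l, drop s l)"]) auto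
  next
    fix l assume "l \<in> (\<lambda>(u, v). u @ v) ` (?U s \<times> wide (k - s))"
    then obtain u v where l: "l = u @ v" "u \<in> dec s" "\<And>i. i < s \<Longrightarrow> k - s + 1 + (s - i) \<le> u ! i"
      "v \<in> wide (k - s)" by auto
    have len: "length u = s"
      using l by (auto simp: dec_def)
    have xu: "k - s + 1 \<le> x" if "x \<in> set u" for x
      using that l(3) len by (metis add_leD1 in_set_conv_nth)
    have v: "sorted_wrt (\<ge>) v" "\<And>x. x \<in> set v \<Longrightarrow> 1 \<le> x \<and> x \<le> k - s"
      "\<And>i. i < k - s \<Longrightarrow> i < length v \<and> k - s - i \<le> v ! i"
      using l(4) by (auto simp: wide_def)
    have "y \<le> x" if "x \<in> set u" "y \<in> set v" for x y
      using xu[OF that(1)] v(2)[OF that(2)] by linarith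
    then have "sorted_wrt (\<ge>) l"
      using l(1,2) v(1) by (auto simp: sorted_wrt_append dec_def)
    moreover have "1 \<le> x" if "x \<in> set l" for x
      using that xu[of x] v(2)[of x] l(1) by auto
    moreover have "triangle_fits l k"
      unfolding triangle_fits_iff_nth
    proof (intro allI impI)
      fix i assume i: "i < k"
      show "i < length l \<and> k - i \<le> l ! i"
      proof (cases "i < s")
        case True
        with l(1) l(3)[of i] len s show ?thesis by (simp add: nth_append)
      next
        case False
        with i have "i - s < k - s" by simp
        with v(3)[of "i - s"] False i l(1) len show ?thesis
          by (simp add: nth_append less_diff_conv2)
      qed
    qed
    moreover have "i < length l \<and> k + 1 - i \<le> l ! i" if "i < s" for i
      using l(3)[OF that] that s l(1) len by (auto simp: nth_append)
    moreover have "l ! s \<le> k - s" if "s < length l"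
      using that l(1) len v(2)[of "v ! 0"] by (auto simp: nth_append)
    ultimately show "l \<in> E s" by (auto simp: E_def)
  qed
  have "{l. sorted_wrt (\<ge>) l \<and> (\<forall>x\<in>set l. 1 \<le> x) \<and> durfee_triangle_size l = k} = (\<Union>s\<in>{..k}. E s)"
    (is "?T = _")
  proof (intro equalityI subsetI)
    fix l assume l: "l \<in> ?T"
    \<comment> \<open>\<open>Q s\<close> says that row \<open>s\<close> misses the staircase of size
      \<open>k + 1\<close>; as that triangle does not fit, some \<open>s \<le> k\<close> qualifies,
      and the least one is the cut.\<close>
    define Q where "Q s \<longleftrightarrow> (s < length l \<longrightarrow> l ! s \<le> k - s)" for s
    have "\<not> triangle_fits l (Suc k)"
      using l by (simp add: durfee_triangle_size_eq_iff)
    then obtain s where s: "s \<le> k" "Q s"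
      by (auto simp: triangle_fits_iff_nth Q_def less_Suc_eq_le Suc_diff_le not_le)
    then obtain t where t: "Q t" "t \<le> k" "\<And>i. i < t \<Longrightarrow> \<not> Q i"
      by (metis LeastI Least_le not_less_Least order_trans)
    have "i < length l \<and> k + 1 - i \<le> l ! i" if "i < t" for i
      using t(3)[OF that] that t(2) by (auto simp: Q_def)
    with t(1) l have "l \<in> E t"
      by (auto simp: E_def Q_def durfee_triangle_size_eq_iff)
    with t(2) show "l \<in> (\<Union>s\<in>{..k}. E s)" by blast
  next
    fix l assume "l \<in> (\<Union>s\<in>{..k}. E s)"
    then obtain s where s: "s \<le> k" "l \<in> E s" by auto
    have "\<not> triangle_fits l (Suc k)"
    proof
      assume "triangle_fits l (Suc k)"
      with s(1) have "s < length l" "Suc k - s \<le> l ! s"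
        by (auto simp: triangle_fits_iff_nth)
      with s show False by (auto simp: E_def)
    qed
    with s show "l \<in> ?T" by (auto simp: E_def durfee_triangle_size_eq_iff)
  qed
  then have "gf ?T = gf (\<Union>s\<in>{..k}. E s)" by simp
  also have "\<dots> = (\<Sum>s\<le>k. gf (E s))"
  proof (rule gf_UN)
    show "level_finite (E s)" for s
      by (rule level_finite_subset[OF level_finite_UN_partitions]) (auto simp: E_def partitions_def)
    fix s t assume st: "s \<in> {..k}" "t \<in> {..k}" "s \<noteq> t"
    have False if "l \<in> E s" "l \<in> E t" "s < t" "t \<le> k" for l s t
    proof -
      have "s < length l" "k + 1 - s \<le> l ! s" "l ! s \<le> k - s"
        using that by (auto simp: E_def)
      with that show False by linarith
    qed
    with st show "E s \<inter> E t = {}"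
      by (auto simp: neq_iff)
  qed simp
  also have "\<dots> = (\<Sum>s\<le>k. fps_X ^ ((k - s + 1) * s) * gf (tall s) * gf (tall (k - s)))"
  proof (rule sum.cong)
    fix s assume "s \<in> {..k}"
    then have "gf (E s) = gf (map ((+) (k - s + 1)) ` tall s) * gf (wide (k - s))"
      by (simp only: E_eq atMost_iff, intro gf_append[where s = s])
        (rule level_finite_map_add_tall level_finite_wide | auto simp: tall_def dec_def)+
    then show "gf (E s) = fps_X ^ ((k - s + 1) * s) * gf (tall s) * gf (tall (k - s))"
      by (simp only: gf_map_add_tall gf_wide)
  qed simp
  finally show ?thesis .
qed

subsection \<open>Degrees and leading coefficients\<close>

text \<open>The coefficient \<open>c\<close> may be 0, so \<open>d\<close> is only an upper bound of the degree.\<close>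

definition lead :: "int fps \<Rightarrow> nat \<Rightarrow> int \<Rightarrow> bool" where
  "lead f d c \<longleftrightarrow> (\<forall>n>d. f $ n = 0) \<and> f $ d = c"

lemma lead_mult:
  assumes "lead f d a" "lead g e b"
  shows "lead (f * g) (d + e) (a * b)"
  unfolding lead_def
proof (intro conjI allI impI)
  fix n assume "d + e < n"
  then have "d < i \<or> e < n - i" for i by linarith
  with assms have "f $ i * g $ (n - i) = 0" for i
    unfolding lead_def by (metis mult_zero_left mult_zero_right)
  then show "(f * g) $ n = 0"
    unfolding fps_mult_nth by (intro sum.neutral) blast
next
  have "f $ i * g $ (d + e - i) = (if i = d then a * b else 0)" for i
    using assms by (cases i d rule: linorder_cases) (auto simp: lead_def)
  then show "(f * g) $ (d + e) = a * b"
    by (simp add: fps_mult_nth)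
qed

text \<open>Discards terms of strictly smaller degree when leading coefficients are added.\<close>

lemma lead_weaken: "lead f d a \<Longrightarrow> d < e \<Longrightarrow> lead f e 0"
  by (auto simp: lead_def)

lemma lead_add: "lead f d a \<Longrightarrow> lead g d b \<Longrightarrow> lead (f + g) d (a + b)"
  by (auto simp: lead_def)

lemma lead_diff: "lead f d a \<Longrightarrow> lead g d b \<Longrightarrow> lead (f - g) d (a - b)"
  by (auto simp: lead_def)

lemma lead_sum: "(\<And>i. i \<in> I \<Longrightarrow> lead (f i) d (a i)) \<Longrightarrow> lead (sum f I) d (sum a I)"
  by (auto simp: lead_def fps_sum_nth)

lemma lead_one: "lead 1 0 1"
  by (auto simp: lead_def)

lemma lead_X_power: "lead (fps_X ^ n) n 1"
  by (auto simp: lead_def fps_X_power_nth)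

definition tri :: "nat \<Rightarrow> nat" where
  "tri n = n * (n + 1) div 2"

lemma tri_0 [simp]: "tri 0 = 0"
  and tri_Suc: "tri (Suc n) = tri n + Suc n"
  by (simp_all add: tri_def)

text \<open>A staircase of size \<open>m + n\<close> splits into staircases of sizes
  \<open>m\<close> and \<open>n\<close> and an \<open>m\<close> by \<open>n\<close>
  rectangle.\<close>

lemma tri_add: "tri (m + n) = tri m + tri n + m * n"
  by (induction n) (simp_all add: tri_Suc)

lemma lead_qfact: "lead (qfact n) (tri n) ((-1) ^ n)"
proof (induction n)
  case 0
  then show ?case by (simp add: lead_one)
next
  case (Suc n)
  have "lead (1 - fps_X ^ Suc n) (Suc n) (0 - 1)"
    by (intro lead_diff lead_X_power lead_weaken[OF lead_one]) simp
  with lead_mult[OF Suc] show ?case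
    unfolding qfact_Suc tri_Suc by fastforce
qed

lemma lead_box: "lead (gf (box n c)) (n * c) 1"
proof (induction n arbitrary: c)
  case 0
  then show ?case by (simp add: box_0_left gf_Nil lead_one)
next
  case (Suc n)
  show ?case
  proof (induction c)
    case 0
    then show ?case by (simp add: gf_box_0_right lead_one)
  next
    case (Suc c)
    have "lead (gf (box n (Suc c)) + fps_X ^ Suc n * gf (box (Suc n) c)) (Suc n + Suc n * c) (0 + 1 * 1)"
      by (intro lead_add lead_mult lead_X_power Suc.IH lead_weaken[OF \<open>\<And>c. lead (gf (box n c)) (n * c) 1\<close>]) simp
    then show ?case by (simp add: gf_box_Suc)
  qed
qed

section \<open>The polynomials P_a\<close>

definition tall_num :: "nat \<Rightarrow> int fps" where
  "tall_num a = qfact a * fps_shift (tri a) (gf (tall a))"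

lemma sum_staircase: "(\<Sum>i<a. a - i) = tri a"
proof (induction a)
  case (Suc a)
  show ?case
    by (subst sum.lessThan_Suc_shift) (simp add: Suc tri_Suc)
qed simp

text \<open>Lists in \<open>tall a\<close> dominate the staircase entrywise, so it is the only one
  of least sum. Thus the shift in \<open>tall_num\<close> loses nothing and P_a has constant term
  1.\<close>

lemma gf_tall_low:
  shows "n < tri a \<Longrightarrow> gf (tall a) $ n = 0" and "gf (tall a) $ tri a = 1"
proof -
  have sum: "sum_list l = (\<Sum>i<a. l ! i)" "(\<Sum>i<a. a - i) \<le> (\<Sum>i<a. l ! i)" if "l \<in> tall a" for l
    using that by (auto simp: tall_def dec_def sum_list_sum_nth atLeast0LessThan intro!: sum_mono)
  then have "tri a \<le> sum_list l" if "l \<in> tall a" for l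
    using that by (simp add: sum_staircase)
  then have "{l \<in> tall a. sum_list l = n} = {}" if "n < tri a"
    using that by (auto simp: not_less[symmetric])
  then show "n < tri a \<Longrightarrow> gf (tall a) $ n = 0"
    by (simp only: gf_nth card.empty)
  let ?d = "map (\<lambda>i. a - i) [0..<a]"
  have d: "?d \<in> tall a" "sum_list ?d = tri a"
    by (auto simp: tall_def dec_def sorted_wrt_iff_nth_less sum_staircase[symmetric] sum_list_sum_nth atLeast0LessThan)
  have "l = ?d" if "l \<in> tall a" "sum_list l = tri a" for l
  proof (rule nth_equalityI)
    have l: "length l = a" "\<And>i. i < a \<Longrightarrow> a - i \<le> l ! i"
      using that by (auto simp: tall_def dec_def)
    then show "length l = length ?d" by simp
    have eq: "(\<Sum>i<a. a - i) = (\<Sum>i<a. l ! i)"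
      using that sum by (simp add: sum_staircase)
    fix i assume "i < length l"
    with l eq have "a - i = l ! i"
      using sum_mono_inv[of "\<lambda>i. a - i" "{..<a}" "\<lambda>i. l ! i" i] by auto
    with l \<open>i < length l\<close> show "l ! i = ?d ! i" by simp
  qed
  with d have "{l \<in> tall a. sum_list l = tri a} = {?d}" by blast
  then show "gf (tall a) $ tri a = 1"
    by (simp only: gf_nth) simp
qed

lemma qfact_gf_tall: "qfact a * gf (tall a) = fps_X ^ tri a * tall_num a"
proof -
  have "gf (tall a) = fps_X ^ tri a * fps_shift (tri a) (gf (tall a))"
    by (rule fps_ext) (auto simp: fps_X_power_mult_nth gf_tall_low(1))
  then show ?thesis
    by (metis tall_num_def mult.left_commute)
qed

lemma tall_num_nth_0: "tall_num a $ 0 = 1"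
  by (simp add: tall_num_def gf_tall_low(2))

text \<open>Multiply \<open>gf_dec_conv_tall\<close> by (q)_a, split as (q)_s (q)_(a-s) times the
  Gaussian binomial of \<open>box s (a - s)\<close>; the factor (q)_s turns G_s into a power of q
  times P_s. The term \<open>s = a\<close> lets one solve for P_a.\<close>

lemma tall_num_recurrence:
  "(\<Sum>s\<le>a. fps_X ^ ((a - s) * s) * (fps_X ^ tri s * tall_num s) *
      (qfact (a - s) * gf (box s (a - s)) * gf (box (a - s) (a - s - 1)))) = 1"
proof -
  have "1 = qfact a * gf (dec a)"
    by (simp add: qfact_gf_dec)
  also have "\<dots> = (\<Sum>s\<le>a. qfact a * (fps_X ^ ((a - s) * s) * gf (tall s) * gf (box (a - s) (a - s - 1))))"
    by (simp add: gf_dec_conv_tall sum_distrib_left)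
  also have "\<dots> = (\<Sum>s\<le>a. fps_X ^ ((a - s) * s) * (fps_X ^ tri s * tall_num s) *
      (qfact (a - s) * gf (box s (a - s)) * gf (box (a - s) (a - s - 1))))"
  proof (rule sum.cong)
    fix s assume "s \<in> {..a}"
    then have "qfact a = qfact s * qfact (a - s) * gf (box s (a - s))"
      by (simp add: qfact_gf_box)
    then show "qfact a * (fps_X ^ ((a - s) * s) * gf (tall s) * gf (box (a - s) (a - s - 1)))
      = fps_X ^ ((a - s) * s) * (fps_X ^ tri s * tall_num s) *
      (qfact (a - s) * gf (box s (a - s)) * gf (box (a - s) (a - s - 1)))"
      unfolding qfact_gf_tall[symmetric] by (simp only: mult_ac)
  qed simp
  finally show ?thesis by simp
qed

lemma lead_X_power_mult_iff: "lead (fps_X ^ m * f) (m + d) c \<longleftrightarrow> lead f d c"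
  by (auto simp: lead_def fps_X_power_mult_nth)
    (metis add_diff_cancel_left' add_less_cancel_left not_add_less1)

lemma lead_tall_num: "lead (tall_num a) (a * (a - 1)) (if a = 0 then 1 else (-1) ^ (a - 1))"
proof (induction a rule: less_induct)
  case (less a)
  show ?case
  proof (cases "a = 0")
    case True
    have "tall 0 = {[]}" by (auto simp: tall_def dec_def)
    then have "tall_num 0 = 1" by (simp add: tall_num_def gf_Nil)
    with True show ?thesis by (simp add: lead_one)
  next
    case False
    define f where "f s = fps_X ^ ((a - s) * s) * (fps_X ^ tri s * tall_num s) *
      (qfact (a - s) * gf (box s (a - s)) * gf (box (a - s) (a - s - 1)))" for s
    let ?D = "tri a + a * (a - 1)"
    have "(\<Sum>s\<le>a. f s) = 1"
      using tall_num_recurrence[of a] by (simp add: f_def)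
    moreover have "{..a} = insert a {..<a}" by auto
    moreover have "f a = fps_X ^ tri a * tall_num a"
      by (simp add: f_def gf_box_0_right)
    ultimately have eq: "fps_X ^ tri a * tall_num a = 1 - (\<Sum>s<a. f s)"
      by (simp add: algebra_simps)
    have "lead (f s) ?D (if s = 0 then (-1) ^ a else 0)" if s: "s < a" for s
    proof -
      define m where "m = a - s"
      have a: "a = s + m" "m > 0" using s by (auto simp: m_def)
      \<comment> \<open>The degrees of the factors of \<open>f s\<close>, added in the order in
        which they are written.\<close>
      define d where "d = m * s + (tri s + s * (s - 1)) + (tri m + s * m + m * (m - 1))"
      have L: "lead (f s) d (1 * (1 * (if s = 0 then 1 else (-1) ^ (s - 1))) * ((-1) ^ m * 1 * 1))"
        unfolding f_def m_def[symmetric] d_def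
        by (intro lead_mult lead_X_power lead_qfact lead_box less s)
      show ?thesis
      proof (cases "s = 0")
        case True
        with L a show ?thesis by (simp add: d_def)
      next
        case False
        then obtain s' m' where sm: "s = Suc s'" "m = Suc m'"
          using a(2) by (metis not0_implies_Suc not_less_zero)
        \<comment> \<open>By \<open>tri_add\<close> the gap is exactly \<open>s * m\<close>, so only
          \<open>s = 0\<close> reaches degree \<open>?D\<close>.\<close>
        have "d < ?D"
          unfolding d_def a(1) tri_add unfolding sm by (simp add: algebra_simps)
        with L False show ?thesis by (simp add: lead_weaken)
      qed
    qed
    then have "lead (\<Sum>s<a. f s) ?D (\<Sum>s<a. if s = 0 then (-1) ^ a else 0)"
      by (intro lead_sum) simp
    moreover have "(\<Sum>s<a. if s = 0 then (-1) ^ a else 0) = ((-1) ^ a :: int)"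
      using False by (simp add: sum.delta)
    \<comment> \<open>So the constant 1 in \<open>eq\<close> leaves the leading coefficient
      alone.\<close>
    moreover have "0 < ?D"
      using False by (cases a) (simp_all add: tri_Suc)
    ultimately have "lead (fps_X ^ tri a * tall_num a) ?D (0 - (-1) ^ a)"
      unfolding eq by (intro lead_diff lead_weaken[OF lead_one]) simp_all
    moreover have "0 - (-1) ^ a = ((-1) ^ (a - 1) :: int)"
      using False by (cases a) simp_all
    ultimately show ?thesis
      using False by (simp add: lead_X_power_mult_iff)
  qed
qed

section \<open>Clearing denominators in the sum for F_k\<close>

lemma lead_imp_fps_of_poly:
  assumes "lead f d c"
  shows "fps_of_poly (\<Sum>i\<le>d. monom (f $ i) i) = f"
proof (rule fps_ext)
  fix n
  show "fps_of_poly (\<Sum>i\<le>d. monom (f $ i) i) $ n = f $ n"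
    using assms by (cases "n \<le> d") (auto simp: coeff_sum lead_def)
qed

lemma gf_box_commute: "gf (box m n) = gf (box n m)"
proof -
  \<comment> \<open>The product formula is symmetric in \<open>m\<close> and \<open>n\<close>, and
    the factors \<open>qfact\<close> cancel.\<close>
  have "qfact m * qfact n * gf (box m n) = qfact m * qfact n * gf (box n m)"
    using qfact_gf_box[of m n] qfact_gf_box[of n m] by (simp add: ac_simps)
  then show ?thesis by simp
qed

text \<open>(q)_k is (q)_s (q)_m times the Gaussian binomial of \<open>box s m\<close>, which clears
  both G_s and G_m. By \<open>tri_add\<close>, (m+1)s + t_s + t_m = t_k + s.\<close>

lemma qfact_gf_durfee_triangle_size:
  "qfact k * gf {l. sorted_wrt (\<ge>) l \<and> (\<forall>x\<in>set l. 1 \<le> x) \<and> durfee_triangle_size l = k}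
   = fps_X ^ tri k * (\<Sum>s\<le>k. fps_X ^ s * tall_num s * tall_num (k - s) * gf (box s (k - s)))"
  unfolding gf_durfee_triangle_size sum_distrib_left
proof (rule sum.cong)
  fix s assume s: "s \<in> {..k}"
  define m where "m = k - s"
  have k: "k = s + m" using s by (simp add: m_def)
  have "qfact k * (fps_X ^ ((m + 1) * s) * gf (tall s) * gf (tall m))
    = fps_X ^ ((m + 1) * s) * (qfact s * gf (tall s)) * (qfact m * gf (tall m)) * gf (box s m)"
    unfolding k qfact_gf_box[symmetric] by (simp only: mult_ac)
  also have "\<dots> = fps_X ^ ((m + 1) * s) * (fps_X ^ tri s * tall_num s) * (fps_X ^ tri m * tall_num m) * gf (box s m)"
    by (simp only: qfact_gf_tall)
  also have "\<dots> = fps_X ^ (((m + 1) * s) + tri s + tri m) * (tall_num s * tall_num m * gf (box s m))"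
    by (simp only: power_add mult_ac)
  also have "((m + 1) * s) + tri s + tri m = tri k + s"
    by (simp add: k tri_add)
  also have "fps_X ^ (tri k + s) * (tall_num s * tall_num m * gf (box s m))
    = fps_X ^ tri k * (fps_X ^ s * tall_num s * tall_num m * gf (box s m))"
    by (simp only: power_add mult_ac)
  finally show "qfact k * (fps_X ^ ((k - s + 1) * s) * gf (tall s) * gf (tall (k - s))) =
    fps_X ^ tri k * (fps_X ^ s * tall_num s * tall_num (k - s) * gf (box s (k - s)))"
    by (simp only: m_def)
qed simp

text \<open>With \<open>m = k - s\<close>, the degree of the term falls short of k^2 by exactly
  m(s+1), so only \<open>s = k\<close> contributes at the top.\<close>

lemma lead_durfee_numerator:
  assumes "k > 0"
  shows "lead (\<Sum>s\<le>k. fps_X ^ s * tall_num s * tall_num (k - s) * gf (box s (k - s))) (k\<^sup>2) ((-1) ^ (k - 1))"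
proof -
  have "lead (fps_X ^ s * tall_num s * tall_num (k - s) * gf (box s (k - s))) (k\<^sup>2)
      (if s = k then (-1) ^ (k - 1) else 0)" if "s \<in> {..k}" for s
  proof -
    define m where "m = k - s"
    have k: "k = s + m" using that by (simp add: m_def)
    define d where "d = s + s * (s - 1) + m * (m - 1) + s * m"
    have L: "lead (fps_X ^ s * tall_num s * tall_num m * gf (box s m)) d
      (1 * (if s = 0 then 1 else (-1) ^ (s - 1)) * (if m = 0 then 1 else (-1) ^ (m - 1)) * 1)"
      unfolding d_def by (intro lead_mult lead_X_power lead_tall_num lead_box)
    show ?thesis
    proof (cases "m = 0")
      case True
      then have "d = k\<^sup>2"
        by (cases s) (simp_all add: d_def k power2_eq_square)
      with L True assms k show ?thesis by simp
    next
      case False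
      then obtain m' where m': "m = Suc m'" by (metis not0_implies_Suc)
      have "d < k\<^sup>2"
        unfolding d_def k m' by (cases s) (simp_all add: power2_eq_square algebra_simps)
      from lead_weaken[OF L this] False k show ?thesis by simp
    qed
  qed
  then have "lead (\<Sum>s\<le>k. fps_X ^ s * tall_num s * tall_num (k - s) * gf (box s (k - s))) (k\<^sup>2)
      (\<Sum>s\<le>k. if s = k then (-1) ^ (k - 1) else 0)"
    by (rule lead_sum)
  then show ?thesis by simp
qed

subsection \<open>The numerator polynomial\<close>

text \<open>The argument stays over the integers to obtain integer coefficients; rationals enter
  only for the final division.\<close>

definition rat_fps :: "int fps \<Rightarrow> rat fps" where
  "rat_fps f = Abs_fps (\<lambda>n. of_int (f $ n))"

lemma rat_fps_nth [simp]: "rat_fps f $ n = of_int (f $ n)"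
  by (simp add: rat_fps_def)

lemma rat_fps_mult: "rat_fps (f * g) = rat_fps f * rat_fps g"
  by (rule fps_ext) (simp add: fps_mult_nth)

lemma rat_fps_X_power: "rat_fps (fps_X ^ n) = fps_X ^ n"
  by (rule fps_ext) (simp add: fps_X_power_nth)

lemma rat_fps_qfact: "rat_fps (qfact n) = (\<Prod>i=1..n. 1 - fps_X ^ i)"
proof (induction n)
  case 0
  show ?case by (rule fps_ext) simp
next
  case (Suc n)
  have "rat_fps (1 - fps_X ^ Suc n) = 1 - fps_X ^ Suc n"
    by (rule fps_ext) (simp add: fps_X_power_nth del: power_Suc)
  with Suc show ?case
    by (simp add: qfact_Suc rat_fps_mult)
qed

lemma rat_fps_fps_of_poly: "rat_fps (fps_of_poly p) = fps_of_poly (map_poly of_int p)"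
  by (rule fps_ext) (simp add: coeff_map_poly)

lemma F_conv_gf:
  "F k = rat_fps (gf {l. sorted_wrt (\<ge>) l \<and> (\<forall>x\<in>set l. 1 \<le> x) \<and> durfee_triangle_size l = k})"
proof (rule fps_ext)
  fix n
  have "{l \<in> partitions n. durfee_triangle_size l = k}
    = {l \<in> {l. sorted_wrt (\<ge>) l \<and> (\<forall>x\<in>set l. 1 \<le> x) \<and> durfee_triangle_size l = k}. sum_list l = n}"
    by (auto simp: partitions_def)
  then show "F k $ n = rat_fps (gf {l. sorted_wrt (\<ge>) l \<and> (\<forall>x\<in>set l. 1 \<le> x) \<and> durfee_triangle_size l = k}) $ n"
    by (simp add: F_def R_def gf_nth)
qed

lemma F_eq:
  assumes "fps_of_poly \<phi> = (\<Sum>s\<le>k. fps_X ^ s * tall_num s * tall_num (k - s) * gf (box s (k - s)))"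
  shows "F k = fps_X ^ (k * (k + 1) div 2) * fps_of_poly (map_poly of_int \<phi>) / (\<Prod>i=1..k. (1 - fps_X ^ i))"
proof -
  let ?d = "\<Prod>i=1..k. 1 - fps_X ^ i :: rat fps"
  have "?d * F k = rat_fps (fps_X ^ tri k * fps_of_poly \<phi>)"
    unfolding F_conv_gf rat_fps_qfact[symmetric] rat_fps_mult[symmetric]
      qfact_gf_durfee_triangle_size assms ..
  also have "\<dots> = fps_X ^ (k * (k + 1) div 2) * fps_of_poly (map_poly of_int \<phi>)"
    by (simp add: rat_fps_mult rat_fps_X_power rat_fps_fps_of_poly tri_def)
  finally have "fps_X ^ (k * (k + 1) div 2) * fps_of_poly (map_poly of_int \<phi>) / ?d = ?d * F k / ?d"
    by simp
  moreover have "?d \<noteq> 0"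
    unfolding rat_fps_qfact[symmetric]
    by (metis fps_zero_nth of_int_1 qfact_nth_0 rat_fps_nth zero_neq_one)
  ultimately show ?thesis by simp
qed

theorem theorem1:
  fixes k :: nat
  assumes "k > 0"
  shows "\<exists>(\<phi> :: int poly) (c :: nat \<Rightarrow> int).
           F k = fps_X ^ (k * (k + 1) div 2) * fps_of_poly (map_poly of_int \<phi>)
                   / (\<Prod>i=1..k. (1 - fps_X ^ i)) \<and>
           \<phi> = 1 + (\<Sum>i=1..k^2 - 1. monom (c i) i) + monom ((-1) ^ (k - 1)) (k^2) \<and>
           degree \<phi> = k^2 \<and>
           (odd k \<longrightarrow> poly \<phi> (-1) = 0)"
proof -
  define f where "f = (\<Sum>s\<le>k. fps_X ^ s * tall_num s * tall_num (k - s) * gf (box s (k - s)))"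
  \<comment> \<open>Each factor is lifted to a polynomial, so that the sum can be evaluated at -1
    term by term.\<close>
  have "\<forall>a. \<exists>q. fps_of_poly q = tall_num a" "\<forall>m n. \<exists>q. fps_of_poly q = gf (box m n)"
    using lead_imp_fps_of_poly lead_tall_num lead_box by blast+
  then obtain p b where p: "\<And>a. fps_of_poly (p a) = tall_num a"
    and b: "\<And>m n. fps_of_poly (b m n) = gf (box m n)"
    by metis
  define \<phi> where "\<phi> = (\<Sum>s\<le>k. monom 1 s * p s * p (k - s) * b s (k - s))"
  have \<phi>_f: "fps_of_poly \<phi> = f"
    by (simp add: \<phi>_def f_def fps_of_poly_sum fps_of_poly_mult fps_of_poly_monom' p b)
  have lead: "lead f (k\<^sup>2) ((-1) ^ (k - 1))"
    unfolding f_def using assms by (rule lead_durfee_numerator)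
  have coeff: "coeff \<phi> n = f $ n" for n
    using \<phi>_f by (metis fps_of_poly_nth)
  have top: "coeff \<phi> (k\<^sup>2) = (-1) ^ (k - 1)" and above: "\<And>n. n > k\<^sup>2 \<Longrightarrow> coeff \<phi> n = 0"
    using lead by (auto simp: coeff lead_def)
  have "f $ 0 = (\<Sum>s\<le>k. if s = 0 then 1 else 0)"
    unfolding f_def fps_sum_nth
  proof (rule sum.cong)
    fix s
    show "(fps_X ^ s * tall_num s * tall_num (k - s) * gf (box s (k - s))) $ 0 = (if s = 0 then 1 else 0)"
      by (cases s) (simp_all add: tall_num_nth_0 box_0_left gf_Nil)
  qed simp
  then have bottom: "coeff \<phi> 0 = 1"
    by (simp add: coeff)
  have "\<phi> = 1 + (\<Sum>i=1..k\<^sup>2 - 1. monom (coeff \<phi> i) i) + monom ((-1) ^ (k - 1)) (k\<^sup>2)"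
  proof (rule poly_eqI)
    fix n
    have pos: "k\<^sup>2 > 0" using assms by simp
    then have not_le: "\<not> k\<^sup>2 \<le> k\<^sup>2 - Suc 0" by linarith
    consider "n = 0" | "0 < n" "n < k\<^sup>2" | "n = k\<^sup>2" | "n > k\<^sup>2" by linarith
    then show "coeff \<phi> n = coeff (1 + (\<Sum>i=1..k\<^sup>2 - 1. monom (coeff \<phi> i) i) + monom ((-1) ^ (k - 1)) (k\<^sup>2)) n"
      using pos not_le by cases (auto simp: coeff_sum bottom top above)
  qed
  moreover have "degree \<phi> = k\<^sup>2"
    using top above by (intro antisym degree_le le_degree) auto
  moreover have "poly \<phi> (-1) = 0" if "odd k"
  proof -
    \<comment> \<open>The chosen polynomials inherit the symmetry because \<open>fps_of_poly\<close>
      is injective.\<close>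
    have b_commute: "b m n = b n m" for m n
      by (metis b gf_box_commute fps_of_poly_eq_iff)
    \<comment> \<open>Replacing \<open>s\<close> by \<open>k - s\<close> fixes the product of the
      three polynomial values and, for odd \<open>k\<close>, flips the sign (-1)^s; so the sum
      equals its own negative.\<close>
    define g where "g s = (-1) ^ s * poly (p s) (-1) * poly (p (k - s)) (-1) * poly (b s (k - s)) (-1)" for s
    have \<phi>_g: "poly \<phi> (-1) = (\<Sum>s\<le>k. g s)"
      by (simp add: \<phi>_def g_def poly_sum poly_monom)
    also have "\<dots> = (\<Sum>s\<le>k. g (k - s))"
      by (rule sum.reindex_bij_witness[of _ "\<lambda>s. k - s" "\<lambda>s. k - s"]) auto
    also have "\<dots> = (\<Sum>s\<le>k. - g s)"
    proof (rule sum.cong)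
      fix s assume "s \<in> {..k}"
      moreover from this have "(-1) ^ (k - s) = - ((-1) ^ s :: int)"
        using that by (cases "even s") auto
      ultimately show "g (k - s) = - g s"
        by (simp add: g_def b_commute[of "k - s"])
    qed simp
    also have "\<dots> = - poly \<phi> (-1)"
      by (simp add: \<phi>_g sum_negf)
    finally show ?thesis by simp
  qed
  ultimately show ?thesis
    using F_eq[OF \<phi>_f[unfolded f_def]] by blast
qed

end
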